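(* Let $k$ be an arbitrary field and let $G$ be a group having a faithful irreducible module $V$ over $k$. Let $A$ be a normal, torsion, abelian subgroup of $G$. Suppose that $[G:C_G(A)]<\infty$. Then $\mathrm{char}(k)\notin\Pi(A)$.
   Context: Groups may be infinite and modules may be infinite dimensional. A $G$-module over $k$ is a left module over the group algebra $kG$; it is faithful if only the identity of $G$ acts trivially, and irreducible if it is nonzero and has no submodules other than $0$ and itself. $C_G(A)$ is the centralizer of $A$ in $G$. For a group $H$, $\Pi(H)$ is the set of all primes $p$ such that $a^p=1$ for some $a\in H$, $a\neq 1$. *)

theory Defs
  imports "HOL-Algebra.Module" "HOL-Algebra.Coset" "HOL-Computational_Algebra.Primes"
begin

section \<open>Group-theoretic notions\<close>

definition centralizer :: "('g, 'n) monoid_scheme \<Rightarrow> 'g set \<Rightarrow> 'g set" where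
  "centralizer G A = {g \<in> carrier G. \<forall>a\<in>A. g \<otimes>\<^bsub>G\<^esub> a = a \<otimes>\<^bsub>G\<^esub> g}"

definition torsion_group :: "('g, 'n) monoid_scheme \<Rightarrow> bool" where
  "torsion_group H \<longleftrightarrow> group H \<and> (\<forall>a\<in>carrier H. \<exists>n::nat. n > 0 \<and> a [^]\<^bsub>H\<^esub> n = \<one>\<^bsub>H\<^esub>)"

definition torsion_primes :: "('g, 'n) monoid_scheme \<Rightarrow> nat set" where
  "torsion_primes H =
     {p. prime p \<and> (\<exists>a\<in>carrier H. a \<noteq> \<one>\<^bsub>H\<^esub> \<and> a [^]\<^bsub>H\<^esub> p = \<one>\<^bsub>H\<^esub>)}"

definition finite_index :: "('g, 'n) monoid_scheme \<Rightarrow> 'g set \<Rightarrow> bool" where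
  "finite_index G H \<longleftrightarrow> finite (rcosets\<^bsub>G\<^esub> H)"

text \<open>\<^const>\<open>semiring_char\<close> is only available for type classes; this is its counterpart
  for rings with a carrier, with value \<open>0\<close> if no positive multiple of \<open>1\<close> vanishes.\<close>

definition ring_char :: "('k, 'm) ring_scheme \<Rightarrow> nat" where
  "ring_char R =
     (if \<exists>n::nat. n > 0 \<and> [n] \<cdot>\<^bsub>R\<^esub> \<one>\<^bsub>R\<^esub> = \<zero>\<^bsub>R\<^esub>
      then LEAST n::nat. n > 0 \<and> [n] \<cdot>\<^bsub>R\<^esub> \<one>\<^bsub>R\<^esub> = \<zero>\<^bsub>R\<^esub> else 0)"


section \<open>The group algebra\<close>

definition ga_support :: "('k, 'm) ring_scheme \<Rightarrow> ('g, 'n) monoid_scheme \<Rightarrow> ('g \<Rightarrow> 'k) \<Rightarrow> 'g set" where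
  "ga_support k G f = {x \<in> carrier G. f x \<noteq> \<zero>\<^bsub>k\<^esub>}"

text \<open>The element \<open>\<Sum>\<^sub>x f(x) x\<close> of \<open>kG\<close> is the finitely supported function \<open>f\<close>, extended by
  zero outside the carrier of \<open>G\<close>; multiplication is convolution.\<close>

definition group_algebra ::
  "('k, 'm) ring_scheme \<Rightarrow> ('g, 'n) monoid_scheme \<Rightarrow> ('g \<Rightarrow> 'k) ring" where
  "group_algebra k G =
    \<lparr>carrier = {f. (\<forall>x\<in>carrier G. f x \<in> carrier k) \<and> (\<forall>x. x \<notin> carrier G \<longrightarrow> f x = \<zero>\<^bsub>k\<^esub>)
                  \<and> finite (ga_support k G f)},
     monoid.mult = (\<lambda>f g x. if x \<in> carrier G
                     then (\<Oplus>\<^bsub>k\<^esub>y\<in>ga_support k G f. f y \<otimes>\<^bsub>k\<^esub> g (inv\<^bsub>G\<^esub> y \<otimes>\<^bsub>G\<^esub> x))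
                     else \<zero>\<^bsub>k\<^esub>),
     one = (\<lambda>x. if x = \<one>\<^bsub>G\<^esub> then \<one>\<^bsub>k\<^esub> else \<zero>\<^bsub>k\<^esub>),
     ring.zero = (\<lambda>x. \<zero>\<^bsub>k\<^esub>),
     ring.add = (\<lambda>f g x. if x \<in> carrier G then f x \<oplus>\<^bsub>k\<^esub> g x else \<zero>\<^bsub>k\<^esub>)\<rparr>"

definition ga_of :: "('k, 'm) ring_scheme \<Rightarrow> 'g \<Rightarrow> 'g \<Rightarrow> 'k" where
  "ga_of k g = (\<lambda>x. if x = g then \<one>\<^bsub>k\<^esub> else \<zero>\<^bsub>k\<^esub>)"


section \<open>Modules over the group algebra\<close>

text \<open>The library's \<^locale>\<open>module\<close> requires a commutative ring of scalars; the axioms here are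
  otherwise the same. The library's \<^locale>\<open>submodule\<close> has no such restriction.\<close>

locale left_module = R?: ring R + M?: abelian_group M
  for R :: "('a, 'm) ring_scheme" and M :: "('a, 'v, 'o) module_scheme" (structure) +
  assumes smult_closed:
      "\<lbrakk>a \<in> carrier R; x \<in> carrier M\<rbrakk> \<Longrightarrow> a \<odot>\<^bsub>M\<^esub> x \<in> carrier M"
    and smult_l_distr:
      "\<lbrakk>a \<in> carrier R; b \<in> carrier R; x \<in> carrier M\<rbrakk> \<Longrightarrow>
       (a \<oplus>\<^bsub>R\<^esub> b) \<odot>\<^bsub>M\<^esub> x = a \<odot>\<^bsub>M\<^esub> x \<oplus>\<^bsub>M\<^esub> b \<odot>\<^bsub>M\<^esub> x"
    and smult_r_distr:
      "\<lbrakk>a \<in> carrier R; x \<in> carrier M; y \<in> carrier M\<rbrakk> \<Longrightarrow>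
       a \<odot>\<^bsub>M\<^esub> (x \<oplus>\<^bsub>M\<^esub> y) = a \<odot>\<^bsub>M\<^esub> x \<oplus>\<^bsub>M\<^esub> a \<odot>\<^bsub>M\<^esub> y"
    and smult_assoc:
      "\<lbrakk>a \<in> carrier R; b \<in> carrier R; x \<in> carrier M\<rbrakk> \<Longrightarrow>
       (a \<otimes>\<^bsub>R\<^esub> b) \<odot>\<^bsub>M\<^esub> x = a \<odot>\<^bsub>M\<^esub> (b \<odot>\<^bsub>M\<^esub> x)"
    and smult_one:
      "x \<in> carrier M \<Longrightarrow> \<one>\<^bsub>R\<^esub> \<odot>\<^bsub>M\<^esub> x = x"

definition irreducible_module ::
  "('a, 'm) ring_scheme \<Rightarrow> ('a, 'v, 'o) module_scheme \<Rightarrow> bool" where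
  "irreducible_module R M \<longleftrightarrow>
     left_module R M \<and> carrier M \<noteq> {\<zero>\<^bsub>M\<^esub>} \<and>
     (\<forall>W. submodule W R M \<longrightarrow> W = {\<zero>\<^bsub>M\<^esub>} \<or> W = carrier M)"

definition faithful_module ::
  "('k, 'm) ring_scheme \<Rightarrow> ('g, 'n) monoid_scheme \<Rightarrow> ('g \<Rightarrow> 'k, 'v, 'o) module_scheme \<Rightarrow> bool" where
  "faithful_module k G V \<longleftrightarrow>
     left_module (group_algebra k G) V \<and>
     (\<forall>g\<in>carrier G. (\<forall>v\<in>carrier V. ga_of k g \<odot>\<^bsub>V\<^esub> v = v) \<longrightarrow> g = \<one>\<^bsub>G\<^esub>)"


section \<open>The group algebra is a ring\<close>

locale ring_and_group = k: ring k + G: group G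
  for k :: "('k, 'm) ring_scheme" and G :: "('g, 'n) monoid_scheme"
begin

abbreviation "kG \<equiv> group_algebra k G"
abbreviation "supp \<equiv> ga_support k G"

lemma ga_mem:
  "f \<in> carrier kG \<longleftrightarrow> (\<forall>x\<in>carrier G. f x \<in> carrier k) \<and>
     (\<forall>x. x \<notin> carrier G \<longrightarrow> f x = \<zero>\<^bsub>k\<^esub>) \<and> finite (supp f)"
  by (simp add: group_algebra_def)

lemma ga_apply: "f \<in> carrier kG \<Longrightarrow> f x \<in> carrier k"
  by (cases "x \<in> carrier G") (auto simp: ga_mem)

lemma ga_outside: "f \<in> carrier kG \<Longrightarrow> x \<notin> carrier G \<Longrightarrow> f x = \<zero>\<^bsub>k\<^esub>"
  by (auto simp: ga_mem)

lemma ga_supp_finite [simp]: "f \<in> carrier kG \<Longrightarrow> finite (supp f)"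
  by (auto simp: ga_mem)

lemma supp_sub: "supp f \<subseteq> carrier G"
  by (auto simp: ga_support_def)

lemma ga_add: "f \<oplus>\<^bsub>kG\<^esub> g = (\<lambda>x. if x \<in> carrier G then f x \<oplus>\<^bsub>k\<^esub> g x else \<zero>\<^bsub>k\<^esub>)"
  by (simp only: group_algebra_def ring.simps)

lemma ga_add_apply:
  "f \<in> carrier kG \<Longrightarrow> g \<in> carrier kG \<Longrightarrow> (f \<oplus>\<^bsub>kG\<^esub> g) x = f x \<oplus>\<^bsub>k\<^esub> g x"
  using ga_outside[of f] ga_outside[of g] by (simp add: ga_add)

lemma ga_zero: "\<zero>\<^bsub>kG\<^esub> = (\<lambda>x. \<zero>\<^bsub>k\<^esub>)"
  by (simp only: group_algebra_def ring.simps)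

lemma ga_one: "\<one>\<^bsub>kG\<^esub> = ga_of k \<one>\<^bsub>G\<^esub>"
  by (simp only: group_algebra_def ga_of_def monoid.simps)

lemma ga_of_closed [simp]: "g \<in> carrier G \<Longrightarrow> ga_of k g \<in> carrier kG"
proof -
  assume g: "g \<in> carrier G"
  have "finite (supp (ga_of k g))"
    by (rule finite_subset[of _ "{g}"]) (auto simp: ga_support_def ga_of_def)
  moreover have "ga_of k g x \<in> carrier k" for x by (simp only: ga_of_def) simp
  moreover have "ga_of k g x = \<zero>\<^bsub>k\<^esub>" if "x \<notin> carrier G" for x
    using that g unfolding ga_of_def by metis
  ultimately show ?thesis by (simp only: ga_mem) blast
qed

lemma ga_mult:
  assumes "f \<in> carrier kG" "g \<in> carrier kG" "x \<in> carrier G"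
    and "finite S" "supp f \<subseteq> S" "S \<subseteq> carrier G"
  shows "(f \<otimes>\<^bsub>kG\<^esub> g) x = (\<Oplus>\<^bsub>k\<^esub>y\<in>S. f y \<otimes>\<^bsub>k\<^esub> g (inv\<^bsub>G\<^esub> y \<otimes>\<^bsub>G\<^esub> x))"
proof -
  have "(f \<otimes>\<^bsub>kG\<^esub> g) x = (\<Oplus>\<^bsub>k\<^esub>y\<in>supp f. f y \<otimes>\<^bsub>k\<^esub> g (inv\<^bsub>G\<^esub> y \<otimes>\<^bsub>G\<^esub> x))"
    using assms(3) by (simp only: group_algebra_def monoid.simps if_True)
  also have "\<dots> = (\<Oplus>\<^bsub>k\<^esub>y\<in>S. f y \<otimes>\<^bsub>k\<^esub> g (inv\<^bsub>G\<^esub> y \<otimes>\<^bsub>G\<^esub> x))"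
  proof (rule k.add.finprod_mono_neutral_cong_left)
    fix y assume "y \<in> S - supp f"
    then have "f y = \<zero>\<^bsub>k\<^esub>" using assms(6) by (auto simp: ga_support_def)
    then show "f y \<otimes>\<^bsub>k\<^esub> g (inv\<^bsub>G\<^esub> y \<otimes>\<^bsub>G\<^esub> x) = \<zero>\<^bsub>k\<^esub>"
      using ga_apply[OF assms(2)] by simp
  qed (use assms(4,5) ga_apply[OF assms(1)] ga_apply[OF assms(2)] in auto)
  finally show ?thesis .
qed

lemma ga_mult_outside: "x \<notin> carrier G \<Longrightarrow> (f \<otimes>\<^bsub>kG\<^esub> g) x = \<zero>\<^bsub>k\<^esub>"
  by (simp only: group_algebra_def monoid.simps if_False)

lemma supp_mult:
  assumes "f \<in> carrier kG" "g \<in> carrier kG"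
  shows "supp (f \<otimes>\<^bsub>kG\<^esub> g) \<subseteq> (\<lambda>(a, b). a \<otimes>\<^bsub>G\<^esub> b) ` (supp f \<times> supp g)"
proof
  fix x assume x: "x \<in> supp (f \<otimes>\<^bsub>kG\<^esub> g)"
  then have xG: "x \<in> carrier G" and ne: "(f \<otimes>\<^bsub>kG\<^esub> g) x \<noteq> \<zero>\<^bsub>k\<^esub>"
    by (auto simp: ga_support_def)
  have "\<exists>y\<in>supp f. f y \<otimes>\<^bsub>k\<^esub> g (inv\<^bsub>G\<^esub> y \<otimes>\<^bsub>G\<^esub> x) \<noteq> \<zero>\<^bsub>k\<^esub>"
  proof (rule ccontr)
    assume "\<not> ?thesis"
    then have "(f \<otimes>\<^bsub>kG\<^esub> g) x = \<zero>\<^bsub>k\<^esub>"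
      using ga_mult[OF assms xG ga_supp_finite[OF assms(1)] subset_refl supp_sub]
      by (simp add: k.add.finprod_one_eqI)
    then show False using ne by simp
  qed
  then obtain y where y: "y \<in> supp f" "f y \<otimes>\<^bsub>k\<^esub> g (inv\<^bsub>G\<^esub> y \<otimes>\<^bsub>G\<^esub> x) \<noteq> \<zero>\<^bsub>k\<^esub>" by blast
  then have yG: "y \<in> carrier G" using supp_sub by blast
  have "g (inv\<^bsub>G\<^esub> y \<otimes>\<^bsub>G\<^esub> x) \<noteq> \<zero>\<^bsub>k\<^esub>" using y ga_apply[OF assms(1)] by auto
  then have "inv\<^bsub>G\<^esub> y \<otimes>\<^bsub>G\<^esub> x \<in> supp g" using xG yG by (auto simp: ga_support_def)
  moreover have "x = y \<otimes>\<^bsub>G\<^esub> (inv\<^bsub>G\<^esub> y \<otimes>\<^bsub>G\<^esub> x)" using xG yG by (simp add: G.m_assoc[symmetric])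
  ultimately show "x \<in> (\<lambda>(a, b). a \<otimes>\<^bsub>G\<^esub> b) ` (supp f \<times> supp g)" using y(1) by force
qed

lemma ga_mult_closed [simp]:
  assumes "f \<in> carrier kG" "g \<in> carrier kG"
  shows "f \<otimes>\<^bsub>kG\<^esub> g \<in> carrier kG"
  unfolding ga_mem
proof (intro conjI ballI allI impI)
  fix x assume "x \<in> carrier G"
  then show "(f \<otimes>\<^bsub>kG\<^esub> g) x \<in> carrier k"
    using ga_mult[OF assms _ ga_supp_finite[OF assms(1)] subset_refl supp_sub]
      ga_apply[OF assms(1)] ga_apply[OF assms(2)] by (simp add: Pi_def)
next
  show "finite (supp (f \<otimes>\<^bsub>kG\<^esub> g))"
    by (rule finite_subset[OF supp_mult[OF assms]]) (use assms in auto)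
qed (simp add: ga_mult_outside)

lemma ga_add_closed [simp]:
  assumes "f \<in> carrier kG" "g \<in> carrier kG"
  shows "f \<oplus>\<^bsub>kG\<^esub> g \<in> carrier kG"
proof -
  have "supp (f \<oplus>\<^bsub>kG\<^esub> g) \<subseteq> supp f \<union> supp g" by (auto simp: ga_add ga_support_def)
  then have "finite (supp (f \<oplus>\<^bsub>kG\<^esub> g))" using assms by (meson finite_UnI finite_subset ga_supp_finite)
  then show ?thesis using assms by (simp add: ga_mem) (simp add: ga_add)
qed

lemma ga_abelian_group: "abelian_group kG"
proof (rule abelian_groupI)
  fix f assume f: "f \<in> carrier kG"
  let ?g = "\<lambda>x. \<ominus>\<^bsub>k\<^esub> f x"
  have "supp ?g \<subseteq> supp f" by (auto simp: ga_support_def)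
  then have "?g \<in> carrier kG"
    using f finite_subset[of "supp ?g" "supp f"] by (auto simp: ga_mem)
  moreover have "?g \<oplus>\<^bsub>kG\<^esub> f = \<zero>\<^bsub>kG\<^esub>" using ga_apply[OF f] by (auto simp: ga_add ga_zero k.l_neg)
  ultimately show "\<exists>g\<in>carrier kG. g \<oplus>\<^bsub>kG\<^esub> f = \<zero>\<^bsub>kG\<^esub>" by blast
next
  show "\<zero>\<^bsub>kG\<^esub> \<in> carrier kG" by (simp add: ga_mem ga_zero ga_support_def)
next
  fix f assume f: "f \<in> carrier kG"
  then show "\<zero>\<^bsub>kG\<^esub> \<oplus>\<^bsub>kG\<^esub> f = f"
    using ga_apply[OF f] ga_outside[OF f] by (auto simp: ga_add ga_zero)
next
  fix f g assume fg: "f \<in> carrier kG" "g \<in> carrier kG"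
  show "f \<oplus>\<^bsub>kG\<^esub> g = g \<oplus>\<^bsub>kG\<^esub> f"
    using ga_apply[OF fg(1)] ga_apply[OF fg(2)] by (auto simp: ga_add k.a_comm)
next
  fix f g h assume fgh: "f \<in> carrier kG" "g \<in> carrier kG" "h \<in> carrier kG"
  show "f \<oplus>\<^bsub>kG\<^esub> g \<oplus>\<^bsub>kG\<^esub> h = f \<oplus>\<^bsub>kG\<^esub> (g \<oplus>\<^bsub>kG\<^esub> h)"
    using ga_apply[OF fgh(1)] ga_apply[OF fgh(2)] ga_apply[OF fgh(3)]
    by (auto simp: ga_add k.a_assoc)
qed simp

lemma finsum_swap:
  assumes "finite A" "finite B" "\<And>a b. a \<in> A \<Longrightarrow> b \<in> B \<Longrightarrow> h a b \<in> carrier k"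
  shows "(\<Oplus>\<^bsub>k\<^esub>a\<in>A. \<Oplus>\<^bsub>k\<^esub>b\<in>B. h a b) = (\<Oplus>\<^bsub>k\<^esub>b\<in>B. \<Oplus>\<^bsub>k\<^esub>a\<in>A. h a b)"
  using assms(1,3)
proof (induction A)
  case (insert a A)
  have h: "h a b \<in> carrier k" "\<And>c. c \<in> A \<Longrightarrow> h c b \<in> carrier k" if "b \<in> B" for b
    using insert.prems that by auto
  have "(\<Oplus>\<^bsub>k\<^esub>b\<in>B. \<Oplus>\<^bsub>k\<^esub>a\<in>insert a A. h a b) = (\<Oplus>\<^bsub>k\<^esub>b\<in>B. h a b \<oplus>\<^bsub>k\<^esub> (\<Oplus>\<^bsub>k\<^esub>a\<in>A. h a b))"
    by (rule k.finsum_cong') (use insert.hyps h in \<open>auto simp: Pi_def\<close>)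
  also have "\<dots> = (\<Oplus>\<^bsub>k\<^esub>b\<in>B. h a b) \<oplus>\<^bsub>k\<^esub> (\<Oplus>\<^bsub>k\<^esub>b\<in>B. \<Oplus>\<^bsub>k\<^esub>a\<in>A. h a b)"
    by (rule k.finsum_addf) (use h in auto)
  also have "\<dots> = (\<Oplus>\<^bsub>k\<^esub>b\<in>B. h a b) \<oplus>\<^bsub>k\<^esub> (\<Oplus>\<^bsub>k\<^esub>a\<in>A. \<Oplus>\<^bsub>k\<^esub>b\<in>B. h a b)"
    using insert.IH insert.prems by simp
  also have "\<dots> = (\<Oplus>\<^bsub>k\<^esub>a\<in>insert a A. \<Oplus>\<^bsub>k\<^esub>b\<in>B. h a b)"
    by (rule k.finsum_insert[symmetric]) (use insert.hyps h in \<open>auto simp: Pi_def\<close>)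
  finally show ?case by simp
qed (simp add: k.finsum_zero)

lemma ga_mult_assoc:
  assumes f: "f \<in> carrier kG" and g: "g \<in> carrier kG" and h: "h \<in> carrier kG"
  shows "(f \<otimes>\<^bsub>kG\<^esub> g) \<otimes>\<^bsub>kG\<^esub> h = f \<otimes>\<^bsub>kG\<^esub> (g \<otimes>\<^bsub>kG\<^esub> h)"
proof
  note cl = ga_apply[OF f] ga_apply[OF g] ga_apply[OF h]
    ga_apply[OF ga_mult_closed[OF f g]] ga_apply[OF ga_mult_closed[OF g h]]
  fix x
  show "((f \<otimes>\<^bsub>kG\<^esub> g) \<otimes>\<^bsub>kG\<^esub> h) x = (f \<otimes>\<^bsub>kG\<^esub> (g \<otimes>\<^bsub>kG\<^esub> h)) x"
  proof (cases "x \<in> carrier G")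
    case x: True
    let ?F = "supp f"
    let ?T = "(\<lambda>(a, b). a \<otimes>\<^bsub>G\<^esub> b) ` (supp f \<times> supp g)"
    have F: "finite ?F" "\<And>y. y \<in> ?F \<Longrightarrow> y \<in> carrier G" using f supp_sub by auto
    have T: "finite ?T" "?T \<subseteq> carrier G" using f g supp_sub by fastforce+
    have TG: "\<And>z. z \<in> ?T \<Longrightarrow> z \<in> carrier G" using T(2) by blast
    have inner: "(\<Oplus>\<^bsub>k\<^esub>z\<in>?T. g (inv\<^bsub>G\<^esub> y \<otimes>\<^bsub>G\<^esub> z) \<otimes>\<^bsub>k\<^esub> h (inv\<^bsub>G\<^esub> z \<otimes>\<^bsub>G\<^esub> x))
        = (g \<otimes>\<^bsub>kG\<^esub> h) (inv\<^bsub>G\<^esub> y \<otimes>\<^bsub>G\<^esub> x)" if y: "y \<in> ?F" for y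
    proof -
      have yG: "y \<in> carrier G" using y F by blast
      let ?S = "(\<lambda>z. inv\<^bsub>G\<^esub> y \<otimes>\<^bsub>G\<^esub> z) ` ?T"
      have "supp g \<subseteq> ?S"
      proof
        fix w assume w: "w \<in> supp g"
        then have wG: "w \<in> carrier G" using supp_sub by blast
        have "w = inv\<^bsub>G\<^esub> y \<otimes>\<^bsub>G\<^esub> (y \<otimes>\<^bsub>G\<^esub> w)" using yG wG by (simp add: G.m_assoc[symmetric])
        moreover have "y \<otimes>\<^bsub>G\<^esub> w \<in> ?T" using y w by force
        ultimately show "w \<in> ?S" by (rule image_eqI)
      qed
      then have "(g \<otimes>\<^bsub>kG\<^esub> h) (inv\<^bsub>G\<^esub> y \<otimes>\<^bsub>G\<^esub> x)
          = (\<Oplus>\<^bsub>k\<^esub>w\<in>?S. g w \<otimes>\<^bsub>k\<^esub> h (inv\<^bsub>G\<^esub> w \<otimes>\<^bsub>G\<^esub> (inv\<^bsub>G\<^esub> y \<otimes>\<^bsub>G\<^esub> x)))"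
        by (intro ga_mult) (use g h x yG T(1) TG in auto)
      also have "\<dots> = (\<Oplus>\<^bsub>k\<^esub>z\<in>?T. g (inv\<^bsub>G\<^esub> y \<otimes>\<^bsub>G\<^esub> z) \<otimes>\<^bsub>k\<^esub>
          h (inv\<^bsub>G\<^esub> (inv\<^bsub>G\<^esub> y \<otimes>\<^bsub>G\<^esub> z) \<otimes>\<^bsub>G\<^esub> (inv\<^bsub>G\<^esub> y \<otimes>\<^bsub>G\<^esub> x)))"
        proof (rule k.finsum_reindex)
        show "inj_on (\<lambda>z. inv\<^bsub>G\<^esub> y \<otimes>\<^bsub>G\<^esub> z) ?T"
        proof (rule inj_onI)
          fix u v assume "u \<in> ?T" "v \<in> ?T" and eq: "inv\<^bsub>G\<^esub> y \<otimes>\<^bsub>G\<^esub> u = inv\<^bsub>G\<^esub> y \<otimes>\<^bsub>G\<^esub> v"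
          then have "u \<in> carrier G" "v \<in> carrier G" by (blast intro: TG)+
          with eq yG show "u = v" by simp
        qed
      qed (use cl in \<open>auto simp: Pi_def\<close>)
      also have "\<dots> = (\<Oplus>\<^bsub>k\<^esub>z\<in>?T. g (inv\<^bsub>G\<^esub> y \<otimes>\<^bsub>G\<^esub> z) \<otimes>\<^bsub>k\<^esub> h (inv\<^bsub>G\<^esub> z \<otimes>\<^bsub>G\<^esub> x))"
      proof (rule k.finsum_cong')
        fix z assume "z \<in> ?T"
        then have zG: "z \<in> carrier G" by (rule TG)
        have "inv\<^bsub>G\<^esub> (inv\<^bsub>G\<^esub> y \<otimes>\<^bsub>G\<^esub> z) \<otimes>\<^bsub>G\<^esub> (inv\<^bsub>G\<^esub> y \<otimes>\<^bsub>G\<^esub> x)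
            = inv\<^bsub>G\<^esub> z \<otimes>\<^bsub>G\<^esub> (y \<otimes>\<^bsub>G\<^esub> (inv\<^bsub>G\<^esub> y \<otimes>\<^bsub>G\<^esub> x))"
          using x yG zG by (simp add: G.inv_mult_group G.m_assoc)
        also have "\<dots> = inv\<^bsub>G\<^esub> z \<otimes>\<^bsub>G\<^esub> x"
          using x yG zG by (simp add: G.m_assoc[symmetric, of y])
        finally show "g (inv\<^bsub>G\<^esub> y \<otimes>\<^bsub>G\<^esub> z) \<otimes>\<^bsub>k\<^esub> h (inv\<^bsub>G\<^esub> (inv\<^bsub>G\<^esub> y \<otimes>\<^bsub>G\<^esub> z) \<otimes>\<^bsub>G\<^esub> (inv\<^bsub>G\<^esub> y \<otimes>\<^bsub>G\<^esub> x))
            = g (inv\<^bsub>G\<^esub> y \<otimes>\<^bsub>G\<^esub> z) \<otimes>\<^bsub>k\<^esub> h (inv\<^bsub>G\<^esub> z \<otimes>\<^bsub>G\<^esub> x)"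
          by simp
      qed (use cl in \<open>auto simp: Pi_def\<close>)
      finally show ?thesis by simp
    qed
    have "((f \<otimes>\<^bsub>kG\<^esub> g) \<otimes>\<^bsub>kG\<^esub> h) x = (\<Oplus>\<^bsub>k\<^esub>z\<in>?T. (f \<otimes>\<^bsub>kG\<^esub> g) z \<otimes>\<^bsub>k\<^esub> h (inv\<^bsub>G\<^esub> z \<otimes>\<^bsub>G\<^esub> x))"
      by (rule ga_mult) (use f g h x T supp_mult[OF f g] in simp_all)
    also have "\<dots> = (\<Oplus>\<^bsub>k\<^esub>z\<in>?T. \<Oplus>\<^bsub>k\<^esub>y\<in>?F. f y \<otimes>\<^bsub>k\<^esub> (g (inv\<^bsub>G\<^esub> y \<otimes>\<^bsub>G\<^esub> z) \<otimes>\<^bsub>k\<^esub> h (inv\<^bsub>G\<^esub> z \<otimes>\<^bsub>G\<^esub> x)))"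
    proof (rule k.finsum_cong')
      fix z assume "z \<in> ?T"
      then have zG: "z \<in> carrier G" by (rule TG)
      have "(f \<otimes>\<^bsub>kG\<^esub> g) z = (\<Oplus>\<^bsub>k\<^esub>y\<in>?F. f y \<otimes>\<^bsub>k\<^esub> g (inv\<^bsub>G\<^esub> y \<otimes>\<^bsub>G\<^esub> z))"
        by (rule ga_mult[OF f g zG F(1) subset_refl supp_sub])
      then have "(f \<otimes>\<^bsub>kG\<^esub> g) z \<otimes>\<^bsub>k\<^esub> h (inv\<^bsub>G\<^esub> z \<otimes>\<^bsub>G\<^esub> x)
          = (\<Oplus>\<^bsub>k\<^esub>y\<in>?F. f y \<otimes>\<^bsub>k\<^esub> g (inv\<^bsub>G\<^esub> y \<otimes>\<^bsub>G\<^esub> z) \<otimes>\<^bsub>k\<^esub> h (inv\<^bsub>G\<^esub> z \<otimes>\<^bsub>G\<^esub> x))"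
        by (simp add: k.finsum_ldistr F cl Pi_def)
      then show "(f \<otimes>\<^bsub>kG\<^esub> g) z \<otimes>\<^bsub>k\<^esub> h (inv\<^bsub>G\<^esub> z \<otimes>\<^bsub>G\<^esub> x)
          = (\<Oplus>\<^bsub>k\<^esub>y\<in>?F. f y \<otimes>\<^bsub>k\<^esub> (g (inv\<^bsub>G\<^esub> y \<otimes>\<^bsub>G\<^esub> z) \<otimes>\<^bsub>k\<^esub> h (inv\<^bsub>G\<^esub> z \<otimes>\<^bsub>G\<^esub> x)))"
        by (simp add: k.m_assoc cl)
    qed (use cl in \<open>auto simp: Pi_def\<close>)
    also have "\<dots> = (\<Oplus>\<^bsub>k\<^esub>y\<in>?F. \<Oplus>\<^bsub>k\<^esub>z\<in>?T. f y \<otimes>\<^bsub>k\<^esub> (g (inv\<^bsub>G\<^esub> y \<otimes>\<^bsub>G\<^esub> z) \<otimes>\<^bsub>k\<^esub> h (inv\<^bsub>G\<^esub> z \<otimes>\<^bsub>G\<^esub> x)))"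
      by (rule finsum_swap[OF T(1) F(1)]) (use cl in \<open>auto simp: Pi_def\<close>)
    also have "\<dots> = (\<Oplus>\<^bsub>k\<^esub>y\<in>?F. f y \<otimes>\<^bsub>k\<^esub> (g \<otimes>\<^bsub>kG\<^esub> h) (inv\<^bsub>G\<^esub> y \<otimes>\<^bsub>G\<^esub> x))"
    proof (rule k.finsum_cong')
      fix y assume "y \<in> ?F"
      from inner[OF this] show "(\<Oplus>\<^bsub>k\<^esub>z\<in>?T. f y \<otimes>\<^bsub>k\<^esub> (g (inv\<^bsub>G\<^esub> y \<otimes>\<^bsub>G\<^esub> z) \<otimes>\<^bsub>k\<^esub> h (inv\<^bsub>G\<^esub> z \<otimes>\<^bsub>G\<^esub> x)))
          = f y \<otimes>\<^bsub>k\<^esub> (g \<otimes>\<^bsub>kG\<^esub> h) (inv\<^bsub>G\<^esub> y \<otimes>\<^bsub>G\<^esub> x)"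
        using k.finsum_rdistr[OF T(1), of "f y"
            "\<lambda>z. g (inv\<^bsub>G\<^esub> y \<otimes>\<^bsub>G\<^esub> z) \<otimes>\<^bsub>k\<^esub> h (inv\<^bsub>G\<^esub> z \<otimes>\<^bsub>G\<^esub> x)"] cl
        by (simp add: Pi_def)
    qed (use cl in \<open>auto simp: Pi_def\<close>)
    also have "\<dots> = (f \<otimes>\<^bsub>kG\<^esub> (g \<otimes>\<^bsub>kG\<^esub> h)) x"
      by (rule ga_mult[symmetric]) (use f g h x supp_sub in simp_all)
    finally show ?thesis .
  qed (simp add: ga_mult_outside)
qed

lemma supp_ga_of: "g \<in> carrier G \<Longrightarrow> supp (ga_of k g) \<subseteq> {g}"
  by (auto simp: ga_support_def ga_of_def)

lemma ga_of_mult_left: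
  assumes "g \<in> carrier G" "f \<in> carrier kG" "x \<in> carrier G"
  shows "(ga_of k g \<otimes>\<^bsub>kG\<^esub> f) x = f (inv\<^bsub>G\<^esub> g \<otimes>\<^bsub>G\<^esub> x)"
proof -
  have "(ga_of k g \<otimes>\<^bsub>kG\<^esub> f) x
      = (\<Oplus>\<^bsub>k\<^esub>y\<in>{g}. ga_of k g y \<otimes>\<^bsub>k\<^esub> f (inv\<^bsub>G\<^esub> y \<otimes>\<^bsub>G\<^esub> x))"
    by (rule ga_mult) (use assms supp_ga_of in auto)
  then show ?thesis using ga_apply[OF assms(2)] by (simp add: ga_of_def)
qed

lemma ga_of_mult:
  assumes "g \<in> carrier G" "h \<in> carrier G"
  shows "ga_of k g \<otimes>\<^bsub>kG\<^esub> ga_of k h = ga_of k (g \<otimes>\<^bsub>G\<^esub> h)"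
proof
  fix x
  show "(ga_of k g \<otimes>\<^bsub>kG\<^esub> ga_of k h) x = ga_of k (g \<otimes>\<^bsub>G\<^esub> h) x"
  proof (cases "x \<in> carrier G")
    case True
    then have "inv\<^bsub>G\<^esub> g \<otimes>\<^bsub>G\<^esub> x = h \<longleftrightarrow> x = g \<otimes>\<^bsub>G\<^esub> h"
      using assms G.inv_solve_left[of h g x] by auto
    then show ?thesis using True assms by (simp add: ga_of_mult_left) (simp add: ga_of_def)
  qed (use assms in \<open>auto simp: ga_mult_outside ga_of_def\<close>)
qed

lemma ga_one_right:
  assumes "f \<in> carrier kG"
  shows "f \<otimes>\<^bsub>kG\<^esub> \<one>\<^bsub>kG\<^esub> = f"
proof
  fix x
  show "(f \<otimes>\<^bsub>kG\<^esub> \<one>\<^bsub>kG\<^esub>) x = f x"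
  proof (cases "x \<in> carrier G")
    case x: True
    let ?S = "insert x (supp f)"
    have "(f \<otimes>\<^bsub>kG\<^esub> \<one>\<^bsub>kG\<^esub>) x = (\<Oplus>\<^bsub>k\<^esub>y\<in>?S. f y \<otimes>\<^bsub>k\<^esub> \<one>\<^bsub>kG\<^esub> (inv\<^bsub>G\<^esub> y \<otimes>\<^bsub>G\<^esub> x))"
      by (rule ga_mult) (use assms x supp_sub in \<open>auto simp: ga_one\<close>)
    also have "\<dots> = (\<Oplus>\<^bsub>k\<^esub>y\<in>?S. if x = y then f y else \<zero>\<^bsub>k\<^esub>)"
    proof (rule k.finsum_cong')
      fix y assume "y \<in> ?S"
      then have yG: "y \<in> carrier G" using x supp_sub by blast
      have "inv\<^bsub>G\<^esub> y \<otimes>\<^bsub>G\<^esub> x = \<one>\<^bsub>G\<^esub> \<longleftrightarrow> x = y"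
        using x yG G.inv_solve_left[of "\<one>\<^bsub>G\<^esub>" y x] by auto
      then show "f y \<otimes>\<^bsub>k\<^esub> \<one>\<^bsub>kG\<^esub> (inv\<^bsub>G\<^esub> y \<otimes>\<^bsub>G\<^esub> x) = (if x = y then f y else \<zero>\<^bsub>k\<^esub>)"
        using ga_apply[OF assms] by (simp add: ga_one ga_of_def)
    qed (use ga_apply[OF assms] in auto)
    also have "\<dots> = f x"
      by (rule k.finsum_singleton) (use assms ga_apply[OF assms] in auto)
    finally show ?thesis .
  qed (simp add: ga_mult_outside ga_outside[OF assms])
qed

lemma ga_one_left:
  assumes "f \<in> carrier kG"
  shows "\<one>\<^bsub>kG\<^esub> \<otimes>\<^bsub>kG\<^esub> f = f"
proof
  fix x
  show "(\<one>\<^bsub>kG\<^esub> \<otimes>\<^bsub>kG\<^esub> f) x = f x"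
    using assms
    by (cases "x \<in> carrier G")
      (simp_all add: ga_one ga_of_mult_left ga_mult_outside ga_outside[OF assms])
qed

lemma ga_distr_left:
  assumes "f \<in> carrier kG" "g \<in> carrier kG" "h \<in> carrier kG"
  shows "(f \<oplus>\<^bsub>kG\<^esub> g) \<otimes>\<^bsub>kG\<^esub> h = f \<otimes>\<^bsub>kG\<^esub> h \<oplus>\<^bsub>kG\<^esub> g \<otimes>\<^bsub>kG\<^esub> h"
proof
  fix x
  show "((f \<oplus>\<^bsub>kG\<^esub> g) \<otimes>\<^bsub>kG\<^esub> h) x = (f \<otimes>\<^bsub>kG\<^esub> h \<oplus>\<^bsub>kG\<^esub> g \<otimes>\<^bsub>kG\<^esub> h) x"
  proof (cases "x \<in> carrier G")
    case x: True
    define S where "S = supp f \<union> supp g"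
    have S: "finite S" "S \<subseteq> carrier G" "supp f \<subseteq> S" "supp g \<subseteq> S"
      using assms supp_sub by (auto simp: S_def)
    have S': "supp (f \<oplus>\<^bsub>kG\<^esub> g) \<subseteq> S"
      by (auto simp: S_def ga_support_def ga_add)
    note cl = ga_apply[OF assms(1)] ga_apply[OF assms(2)] ga_apply[OF assms(3)]
    have "((f \<oplus>\<^bsub>kG\<^esub> g) \<otimes>\<^bsub>kG\<^esub> h) x
        = (\<Oplus>\<^bsub>k\<^esub>y\<in>S. f y \<otimes>\<^bsub>k\<^esub> h (inv\<^bsub>G\<^esub> y \<otimes>\<^bsub>G\<^esub> x) \<oplus>\<^bsub>k\<^esub> g y \<otimes>\<^bsub>k\<^esub> h (inv\<^bsub>G\<^esub> y \<otimes>\<^bsub>G\<^esub> x))"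
      using assms x S S' by (simp add: ga_mult[of _ _ _ S] ga_add_apply k.l_distr cl)
    also have "\<dots> = (f \<otimes>\<^bsub>kG\<^esub> h) x \<oplus>\<^bsub>k\<^esub> (g \<otimes>\<^bsub>kG\<^esub> h) x"
      using assms x S by (simp add: ga_mult[of _ _ _ S] k.finsum_addf Pi_def cl)
    finally show ?thesis using assms by (simp add: ga_add_apply)
  qed (simp add: ga_mult_outside ga_add)
qed

lemma ga_distr_right:
  assumes "f \<in> carrier kG" "g \<in> carrier kG" "h \<in> carrier kG"
  shows "h \<otimes>\<^bsub>kG\<^esub> (f \<oplus>\<^bsub>kG\<^esub> g) = h \<otimes>\<^bsub>kG\<^esub> f \<oplus>\<^bsub>kG\<^esub> h \<otimes>\<^bsub>kG\<^esub> g"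
proof
  fix x
  show "(h \<otimes>\<^bsub>kG\<^esub> (f \<oplus>\<^bsub>kG\<^esub> g)) x = (h \<otimes>\<^bsub>kG\<^esub> f \<oplus>\<^bsub>kG\<^esub> h \<otimes>\<^bsub>kG\<^esub> g) x"
  proof (cases "x \<in> carrier G")
    case x: True
    have S: "finite (supp h)" "supp h \<subseteq> carrier G" using assms supp_sub by auto
    show ?thesis
      using assms x S
      by (simp add: ga_mult[of _ _ _ "supp h"] ga_add_apply k.r_distr k.finsum_addf Pi_def
          ga_apply[OF assms(1)] ga_apply[OF assms(2)] ga_apply[OF assms(3)])
  qed (simp add: ga_mult_outside ga_add)
qed

lemma ring_group_algebra: "ring kG"
proof (rule ringI)
  show "abelian_group kG" by (rule ga_abelian_group)
  show "Group.monoid kG"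
    by (rule monoidI) (auto simp: ga_mult_assoc ga_one_left ga_one_right, simp add: ga_one)
qed (auto simp: ga_distr_left ga_distr_right)

end

end

theory Submission
  imports Defs
begin

text \<open>
  Suppose \<open>p = char k\<close> and \<open>a \<in> A\<close> has order \<open>p\<close>. Elements of the same right coset of
  \<open>C\<^sub>G(A)\<close> conjugate \<open>a\<close> to the same element, so the finite index makes the set \<open>C\<close> of
  conjugates of \<open>a\<close> finite; it lies in the abelian group \<open>A\<close>, and each of its members has
  \<open>p\<close>-th power \<open>1\<close>.

  In characteristic \<open>p\<close> the elements \<open>b - 1\<close> of \<open>kG\<close>, for \<open>b \<in> C\<close>, are therefore nilpotent,
  because \<open>1 = b\<^sup>p = (1 + (b - 1))\<^sup>p = 1 + (b - 1)\<^sup>p\<close> (lemma \<open>nilpotent_minus_one\<close>), and they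
  commute. Finitely many commuting nilpotent elements have a common nonzero null vector in every
  nonzero module (lemma \<open>common_null_vector\<close>): \<open>C\<close> fixes some \<open>v \<noteq> 0\<close> in \<open>V\<close>. Since \<open>C\<close> is
  closed under conjugation, the vectors fixed by \<open>C\<close> form a \<open>kG\<close>-submodule
  (lemma \<open>fixed_points_submodule\<close>). By irreducibility it is all of \<open>V\<close>, so \<open>a\<close> acts trivially,
  contradicting faithfulness.
\<close>

section \<open>Elements of p-power one in characteristic p\<close>

context ring
begin

lemma binomial_one_plus:
  assumes x: "x \<in> carrier R"
  shows "(x \<oplus> \<one>) [^] n = (\<Oplus>i\<in>{..n}. [(n choose i)] \<cdot> (x [^] i))"
proof (induction n)
  case 0
  show ?case by simp
next
  case (Suc n)
  let ?f = "\<lambda>i. [(n choose i)] \<cdot> (x [^] i)"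
  let ?S = "\<Oplus>i\<in>{..n}. ?f i"
  let ?T = "\<Oplus>i\<in>{..n}. ?f (Suc i)"
  let ?U = "\<Oplus>i\<in>{..n}. [(n choose i)] \<cdot> (x [^] Suc i)"
  have cl: "?S \<in> carrier R" "?T \<in> carrier R" "?U \<in> carrier R"
    using x by (auto intro!: finsum_closed simp del: nat_pow_Suc)
  have S: "?S = ?T \<oplus> \<one>"
  proof -
    have "?S = (\<Oplus>i\<in>{..Suc n}. ?f i)"
      using x cl by (simp add: finsum_Suc binomial_eq_0)
    also have "\<dots> = ?T \<oplus> ?f 0"
      by (rule finsum_Suc2) (use x in auto)
    finally show ?thesis by simp
  qed
  have Sx: "?S \<otimes> x = ?U"
    using x by (simp add: finsum_ldistr add_pow_ldistr)
  have "(x \<oplus> \<one>) [^] Suc n = ?S \<otimes> (x \<oplus> \<one>)"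
    by (simp only: nat_pow_Suc Suc.IH)
  also have "\<dots> = ?S \<otimes> x \<oplus> ?S"
    using x cl by (simp add: r_distr)
  also have "\<dots> = ?U \<oplus> (?T \<oplus> \<one>)"
    by (rule arg_cong2[OF Sx S])
  also have "\<dots> = (?U \<oplus> ?T) \<oplus> \<one>"
    by (rule a_assoc[symmetric]) (use cl in auto)
  also have "?U \<oplus> ?T = (\<Oplus>i\<in>{..n}. [(n choose i)] \<cdot> (x [^] Suc i) \<oplus> ?f (Suc i))"
    by (rule finsum_addf[symmetric]) (use x in auto)
  also have "\<dots> = (\<Oplus>i\<in>{..n}. [(Suc n choose Suc i)] \<cdot> (x [^] Suc i))"
    using x by (intro finsum_cong') (auto simp: add.nat_pow_mult simp del: nat_pow_Suc)
  also have "\<dots> \<oplus> \<one> = (\<Oplus>i\<in>{..n}. [(Suc n choose Suc i)] \<cdot> (x [^] Suc i))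
      \<oplus> [(Suc n choose 0)] \<cdot> (x [^] (0::nat))"
    by simp
  also have "\<dots> = (\<Oplus>i\<in>{..Suc n}. [(Suc n choose i)] \<cdot> (x [^] i))"
    by (rule finsum_Suc2[symmetric]) (use x in auto)
  finally show ?case .
qed

lemma add_pow_dvd_zero:
  assumes x: "x \<in> carrier R" and p: "[(p::nat)] \<cdot> \<one> = \<zero>" and dvd: "p dvd n"
  shows "[n] \<cdot> x = \<zero>"
proof -
  obtain m where m: "n = p * m" using dvd by blast
  have "[p] \<cdot> x = ([p] \<cdot> \<one>) \<otimes> x"
    using x by (simp add: add_pow_ldistr)
  then have "[p] \<cdot> x = \<zero>" using p x by simp
  then show ?thesis using x by (simp add: m add.nat_pow_pow[symmetric])
qed

text \<open>For \<open>0 < i < p\<close> the coefficient \<open>p choose i\<close> is divisible by \<open>p\<close>, so only the two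
  extreme terms of the binomial expansion survive.\<close>

lemma one_plus_pow_char:
  assumes x: "x \<in> carrier R" and p: "prime p" "[(p::nat)] \<cdot> \<one> = \<zero>"
  shows "(x \<oplus> \<one>) [^] p = x [^] p \<oplus> \<one>"
proof -
  obtain n where n: "p = Suc n" using prime_gt_0_nat[OF p(1)] gr0_conv_Suc by blast
  let ?f = "\<lambda>i. [(p choose i)] \<cdot> (x [^] i)"
  have f: "?f \<in> A \<rightarrow> carrier R" for A using x by simp
  have "(x \<oplus> \<one>) [^] p = (\<Oplus>i\<in>{..Suc n}. ?f i)"
    unfolding n[symmetric] by (rule binomial_one_plus[OF x])
  also have "\<dots> = ?f (Suc n) \<oplus> (\<Oplus>i\<in>{..n}. ?f i)"
    by (rule finsum_Suc[OF f])
  also have "\<dots> = (\<Oplus>i\<in>{..n}. ?f i) \<oplus> x [^] p"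
    unfolding n[symmetric] using x a_comm[OF _ finsum_closed[OF f], of "x [^] p" "{..n}"] by simp
  also have "(\<Oplus>i\<in>{..n}. [(p choose i)] \<cdot> (x [^] i)) = (\<Oplus>i\<in>{..n}. if 0 = i then \<one> else \<zero>)"
  proof (rule finsum_cong')
    fix i assume i: "i \<in> {..n}"
    show "[(p choose i)] \<cdot> (x [^] i) = (if 0 = i then \<one> else \<zero>)"
    proof (cases "i = 0")
      case False
      have "p dvd (p choose i)"
        by (rule dvd_choose_prime) (use i n False p in auto)
      then show ?thesis using False x p by (simp add: add_pow_dvd_zero[of _ p])
    qed simp
  qed auto
  also have "\<dots> = \<one>" by (rule add.finprod_singleton) auto
  finally show ?thesis using x by (simp add: a_comm)
qed

lemma minus_one_commute:
  assumes "u \<in> carrier R" "v \<in> carrier R" "u \<otimes> v = v \<otimes> u"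
  shows "(u \<ominus> \<one>) \<otimes> (v \<ominus> \<one>) = (v \<ominus> \<one>) \<otimes> (u \<ominus> \<one>)"
  using assms by (simp add: minus_eq l_distr r_distr l_minus r_minus minus_add a_ac)

lemma nilpotent_minus_one:
  assumes u: "u \<in> carrier R" "u [^] p = \<one>" and p: "prime p" "[(p::nat)] \<cdot> \<one> = \<zero>"
  shows "(u \<ominus> \<one>) [^] p = \<zero>"
proof -
  have x: "u \<ominus> \<one> \<in> carrier R" using u by simp
  have "(u \<ominus> \<one>) \<oplus> \<one> = u" using u by (simp add: minus_eq a_assoc l_neg)
  with one_plus_pow_char[OF x p] u have "(u \<ominus> \<one>) [^] p \<oplus> \<one> = \<zero> \<oplus> \<one>" by simp
  then show ?thesis using x by (simp only: add.right_cancel nat_pow_closed one_closed zero_closed)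
qed

end

section \<open>Commuting nilpotent scalars\<close>

context left_module
begin

lemma smult_r_null: "a \<in> carrier R \<Longrightarrow> a \<odot>\<^bsub>M\<^esub> \<zero>\<^bsub>M\<^esub> = \<zero>\<^bsub>M\<^esub>"
  by (metis M.add.l_cancel_one' M.zero_closed M.l_zero smult_closed smult_r_distr)

lemma smult_l_null: "x \<in> carrier M \<Longrightarrow> \<zero>\<^bsub>R\<^esub> \<odot>\<^bsub>M\<^esub> x = \<zero>\<^bsub>M\<^esub>"
  by (metis M.add.l_cancel_one' R.zero_closed R.l_zero smult_closed smult_l_distr)

lemma smult_r_minus:
  assumes a: "a \<in> carrier R" and x: "x \<in> carrier M"
  shows "a \<odot>\<^bsub>M\<^esub> (\<ominus>\<^bsub>M\<^esub> x) = \<ominus>\<^bsub>M\<^esub> (a \<odot>\<^bsub>M\<^esub> x)"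
proof -
  have "a \<odot>\<^bsub>M\<^esub> (\<ominus>\<^bsub>M\<^esub> x) \<oplus>\<^bsub>M\<^esub> a \<odot>\<^bsub>M\<^esub> x = \<zero>\<^bsub>M\<^esub>"
    using a x by (simp add: smult_r_distr[symmetric] M.l_neg smult_r_null)
  then show ?thesis using a x by (simp add: M.minus_equality smult_closed)
qed

text \<open>A vector killed by all but one element \<open>s\<close> stays so under the powers of \<open>s\<close>, which
  commute with the others; its last nonzero image under these powers is killed by \<open>s\<close> too.\<close>

lemma common_null_vector:
  assumes "finite S" and "S \<subseteq> carrier R"
    and "\<And>s t. s \<in> S \<Longrightarrow> t \<in> S \<Longrightarrow> s \<otimes>\<^bsub>R\<^esub> t = t \<otimes>\<^bsub>R\<^esub> s"
    and "\<And>s. s \<in> S \<Longrightarrow> \<exists>n::nat. s [^]\<^bsub>R\<^esub> n = \<zero>\<^bsub>R\<^esub>"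
    and "carrier M \<noteq> {\<zero>\<^bsub>M\<^esub>}"
  obtains w where "w \<in> carrier M" "w \<noteq> \<zero>\<^bsub>M\<^esub>" "\<And>s. s \<in> S \<Longrightarrow> s \<odot>\<^bsub>M\<^esub> w = \<zero>\<^bsub>M\<^esub>"
proof -
  have "\<exists>w\<in>carrier M. w \<noteq> \<zero>\<^bsub>M\<^esub> \<and> (\<forall>s\<in>S. s \<odot>\<^bsub>M\<^esub> w = \<zero>\<^bsub>M\<^esub>)"
    using assms(1-4)
  proof (induction S)
    case empty
    then show ?case using assms(5) M.zero_closed by blast
  next
    case (insert s S)
    have "\<exists>w\<in>carrier M. w \<noteq> \<zero>\<^bsub>M\<^esub> \<and> (\<forall>s\<in>S. s \<odot>\<^bsub>M\<^esub> w = \<zero>\<^bsub>M\<^esub>)"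
      by (rule insert.IH) (use insert.prems in auto)
    then obtain w where w: "w \<in> carrier M" "w \<noteq> \<zero>\<^bsub>M\<^esub>" "\<And>t. t \<in> S \<Longrightarrow> t \<odot>\<^bsub>M\<^esub> w = \<zero>\<^bsub>M\<^esub>"
      by blast
    have s: "s \<in> carrier R" using insert.prems(1) by simp
    obtain n :: nat where "s [^]\<^bsub>R\<^esub> n = \<zero>\<^bsub>R\<^esub>" using insert.prems(3) by blast
    then have n: "(s [^]\<^bsub>R\<^esub> n) \<odot>\<^bsub>M\<^esub> w = \<zero>\<^bsub>M\<^esub>" using w(1) by (simp add: smult_l_null)
    define l where "l = (LEAST n::nat. (s [^]\<^bsub>R\<^esub> n) \<odot>\<^bsub>M\<^esub> w = \<zero>\<^bsub>M\<^esub>)"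
    have l: "(s [^]\<^bsub>R\<^esub> l) \<odot>\<^bsub>M\<^esub> w = \<zero>\<^bsub>M\<^esub>" unfolding l_def using n by (rule LeastI)
    have "l \<noteq> 0"
    proof
      assume "l = 0"
      then have "\<one>\<^bsub>R\<^esub> \<odot>\<^bsub>M\<^esub> w = \<zero>\<^bsub>M\<^esub>" using l by simp
      then show False using smult_one[OF w(1)] w(2) by simp
    qed
    then obtain m where m: "l = Suc m" using not0_implies_Suc by blast
    define w' where "w' = (s [^]\<^bsub>R\<^esub> m) \<odot>\<^bsub>M\<^esub> w"
    have "w' \<noteq> \<zero>\<^bsub>M\<^esub>"
      using not_less_Least[of m "\<lambda>n. (s [^]\<^bsub>R\<^esub> n) \<odot>\<^bsub>M\<^esub> w = \<zero>\<^bsub>M\<^esub>"] m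
      by (simp add: w'_def l_def)
    moreover have "w' \<in> carrier M" using s w by (simp add: w'_def smult_closed)
    moreover have "s \<odot>\<^bsub>M\<^esub> w' = \<zero>\<^bsub>M\<^esub>"
      using l s w R.nat_pow_Suc2[OF s, of m] by (simp add: w'_def smult_assoc[symmetric] m)
    moreover have "t \<odot>\<^bsub>M\<^esub> w' = \<zero>\<^bsub>M\<^esub>" if t: "t \<in> S" for t
    proof -
      have tR: "t \<in> carrier R" using t insert.prems(1) by blast
      have "s \<otimes>\<^bsub>R\<^esub> t = t \<otimes>\<^bsub>R\<^esub> s" by (rule insert.prems(2)) (use t in auto)
      then have "t \<otimes>\<^bsub>R\<^esub> s [^]\<^bsub>R\<^esub> m = s [^]\<^bsub>R\<^esub> m \<otimes>\<^bsub>R\<^esub> t"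
        using R.group_commutes_pow[of s t m] s tR by simp
      then have "t \<odot>\<^bsub>M\<^esub> w' = (s [^]\<^bsub>R\<^esub> m) \<odot>\<^bsub>M\<^esub> (t \<odot>\<^bsub>M\<^esub> w)"
        using s tR w(1) by (simp add: w'_def smult_assoc[symmetric])
      then show ?thesis using w(3)[OF t] s by (simp add: smult_r_null)
    qed
    ultimately show ?case by (metis insert_iff)
  qed
  then show ?thesis using that by blast
qed

end

section \<open>Fixed points of a conjugation-invariant set\<close>

context ring_and_group
begin

text \<open>The scalar multiple \<open>c g\<close> of a group element. Every element of \<open>kG\<close> is a finite sum of
  such elements, which reduces additive statements on \<open>kG\<close> to them.\<close>

definition ga_single :: "'k \<Rightarrow> 'g \<Rightarrow> 'g \<Rightarrow> 'k" where
  "ga_single c g = (\<lambda>x. if x = g then c else \<zero>\<^bsub>k\<^esub>)"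

lemma supp_ga_single: "supp (ga_single c g) \<subseteq> {g}"
  by (auto simp: ga_support_def ga_single_def)

lemma ga_single_closed:
  assumes "c \<in> carrier k" "g \<in> carrier G"
  shows "ga_single c g \<in> carrier kG"
proof -
  have "finite (supp (ga_single c g))"
    by (rule finite_subset[OF supp_ga_single]) simp
  moreover have "ga_single c g x \<in> carrier k" for x
    using assms(1) unfolding ga_single_def by (cases "x = g") simp_all
  moreover have "ga_single c g x = \<zero>\<^bsub>k\<^esub>" if "x \<notin> carrier G" for x
    using that assms(2) unfolding ga_single_def by metis
  ultimately show ?thesis unfolding ga_mem by blast
qed

lemma ga_of_mult_single:
  assumes "c \<in> carrier k" "g \<in> carrier G" "h \<in> carrier G"
  shows "ga_of k h \<otimes>\<^bsub>kG\<^esub> ga_single c g = ga_single c (h \<otimes>\<^bsub>G\<^esub> g)"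
proof
  fix x
  show "(ga_of k h \<otimes>\<^bsub>kG\<^esub> ga_single c g) x = ga_single c (h \<otimes>\<^bsub>G\<^esub> g) x"
  proof (cases "x \<in> carrier G")
    case True
    then have "inv\<^bsub>G\<^esub> h \<otimes>\<^bsub>G\<^esub> x = g \<longleftrightarrow> x = h \<otimes>\<^bsub>G\<^esub> g"
      by (intro G.inv_solve_left') (use assms in auto)
    then show ?thesis
      using True assms by (simp add: ga_of_mult_left ga_single_closed) (simp add: ga_single_def)
  next
    case False
    then have "x \<noteq> h \<otimes>\<^bsub>G\<^esub> g" using assms by auto
    with False show ?thesis by (simp add: ga_mult_outside) (simp add: ga_single_def)
  qed
qed

lemma ga_single_mult_of:
  assumes "c \<in> carrier k" "g \<in> carrier G" "h \<in> carrier G"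
  shows "ga_single c g \<otimes>\<^bsub>kG\<^esub> ga_of k h = ga_single c (g \<otimes>\<^bsub>G\<^esub> h)"
proof
  fix x
  show "(ga_single c g \<otimes>\<^bsub>kG\<^esub> ga_of k h) x = ga_single c (g \<otimes>\<^bsub>G\<^esub> h) x"
  proof (cases "x \<in> carrier G")
    case True
    have eq: "inv\<^bsub>G\<^esub> g \<otimes>\<^bsub>G\<^esub> x = h \<longleftrightarrow> x = g \<otimes>\<^bsub>G\<^esub> h"
      by (intro G.inv_solve_left') (use True assms in auto)
    have "(ga_single c g \<otimes>\<^bsub>kG\<^esub> ga_of k h) x
        = (\<Oplus>\<^bsub>k\<^esub>y\<in>{g}. ga_single c g y \<otimes>\<^bsub>k\<^esub> ga_of k h (inv\<^bsub>G\<^esub> y \<otimes>\<^bsub>G\<^esub> x))"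
      by (rule ga_mult) (use True assms supp_ga_single in \<open>auto simp: ga_single_closed\<close>)
    also have "\<dots> = c \<otimes>\<^bsub>k\<^esub> ga_of k h (inv\<^bsub>G\<^esub> g \<otimes>\<^bsub>G\<^esub> x)"
      using assms True ga_apply[OF ga_of_closed[of h]] by (simp add: ga_single_def)
    finally show ?thesis using assms eq by (simp add: ga_of_def ga_single_def)
  next
    case False
    then have "x \<noteq> g \<otimes>\<^bsub>G\<^esub> h" using assms by auto
    with False show ?thesis by (simp add: ga_mult_outside) (simp add: ga_single_def)
  qed
qed

lemma ga_induct [consumes 1, case_names zero single add]:
  assumes f: "f \<in> carrier kG"
    and zero: "P \<zero>\<^bsub>kG\<^esub>"
    and single: "\<And>c g. c \<in> carrier k \<Longrightarrow> g \<in> carrier G \<Longrightarrow> P (ga_single c g)"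
    and add: "\<And>f g. \<lbrakk>f \<in> carrier kG; g \<in> carrier kG; P f; P g\<rbrakk> \<Longrightarrow> P (f \<oplus>\<^bsub>kG\<^esub> g)"
  shows "P f"
proof -
  have "P f" if "finite S" "f \<in> carrier kG" "supp f \<subseteq> S" for S f
    using that
  proof (induction S arbitrary: f)
    case empty
    then have "f = \<zero>\<^bsub>kG\<^esub>"
      using ga_outside[of f] by (auto simp: ga_zero ga_support_def)
    then show ?case using zero by simp
  next
    case (insert g S)
    show ?case
    proof (cases "g \<in> carrier G")
      case g: True
      let ?f = "f(g := \<zero>\<^bsub>k\<^esub>)"
      have "supp ?f \<subseteq> supp f" by (auto simp: ga_support_def)
      then have "finite (supp ?f)"
        by (rule finite_subset) (use insert.prems(1) in simp)
      moreover have "?f x \<in> carrier k" for x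
        using ga_apply[OF insert.prems(1)] by simp
      moreover have "?f x = \<zero>\<^bsub>k\<^esub>" if "x \<notin> carrier G" for x
        using ga_outside[OF insert.prems(1) that] by simp
      ultimately have f': "?f \<in> carrier kG" unfolding ga_mem by blast
      have fg: "f g \<in> carrier k" using insert.prems(1) by (rule ga_apply)
      have s: "ga_single (f g) g \<in> carrier kG" using fg g by (rule ga_single_closed)
      have "P ?f"
        by (rule insert.IH[OF f']) (use insert.prems(2) in \<open>auto simp: ga_support_def\<close>)
      moreover have "P (ga_single (f g) g)" using fg g by (rule single)
      moreover have "f = ga_single (f g) g \<oplus>\<^bsub>kG\<^esub> ?f"
        using s f' ga_apply[OF insert.prems(1)]
        by (auto simp: ga_add_apply ga_single_def)
      ultimately show ?thesis using add[OF s f'] by simp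
    next
      case False
      then show ?thesis
        using insert.IH[OF insert.prems(1)] insert.prems(2) by (auto simp: ga_support_def)
    qed
  qed
  then show ?thesis using f ga_supp_finite by blast
qed

lemma ga_of_pow:
  assumes "g \<in> carrier G"
  shows "ga_of k g [^]\<^bsub>kG\<^esub> (n::nat) = ga_of k (g [^]\<^bsub>G\<^esub> n)"
proof -
  interpret kG: ring kG by (rule ring_group_algebra)
  show ?thesis using assms
    by (induction n) (simp_all add: ga_one ga_of_mult)
qed

lemma ga_char:
  assumes "[(n::nat)] \<cdot>\<^bsub>k\<^esub> \<one>\<^bsub>k\<^esub> = \<zero>\<^bsub>k\<^esub>"
  shows "[n] \<cdot>\<^bsub>kG\<^esub> \<one>\<^bsub>kG\<^esub> = \<zero>\<^bsub>kG\<^esub>"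
proof -
  interpret kG: ring kG by (rule ring_group_algebra)
  have "[m] \<cdot>\<^bsub>kG\<^esub> \<one>\<^bsub>kG\<^esub> = ga_single ([m] \<cdot>\<^bsub>k\<^esub> \<one>\<^bsub>k\<^esub>) \<one>\<^bsub>G\<^esub>" for m :: nat
    by (induction m) (auto simp: ga_zero ga_single_def ga_add ga_one ga_of_def)
  then show ?thesis by (simp only: assms ga_single_def ga_zero if_cancel)
qed

text \<open>For \<open>b \<in> C\<close>, \<open>g \<in> G\<close> and a vector \<open>w\<close> fixed by \<open>C\<close>, the vector \<open>g w\<close> is again fixed
  by \<open>b\<close>, as \<open>b g w = g (g\<^sup>-\<^sup>1 b g) w = g w\<close>.\<close>

lemma fixed_points_submodule:
  assumes V: "left_module kG V"
    and C: "C \<subseteq> carrier G"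
    and conj: "\<And>g b. g \<in> carrier G \<Longrightarrow> b \<in> C \<Longrightarrow> inv\<^bsub>G\<^esub> g \<otimes>\<^bsub>G\<^esub> b \<otimes>\<^bsub>G\<^esub> g \<in> C"
  shows "submodule {w \<in> carrier V. \<forall>b\<in>C. ga_of k b \<odot>\<^bsub>V\<^esub> w = w} kG V" (is "submodule ?W kG V")
proof -
  interpret V: left_module kG V by (rule V)
  have of_cl: "ga_of k b \<in> carrier kG" if "b \<in> C" for b
    using that C ga_of_closed by blast
  have single_smult: "ga_single c g \<odot>\<^bsub>V\<^esub> w \<in> ?W"
    if c: "c \<in> carrier k" and g: "g \<in> carrier G" and w: "w \<in> ?W" for c g w
  proof -
    have s: "ga_single c g \<in> carrier kG" using c g by (rule ga_single_closed)
    have "ga_of k b \<odot>\<^bsub>V\<^esub> (ga_single c g \<odot>\<^bsub>V\<^esub> w) = ga_single c g \<odot>\<^bsub>V\<^esub> w" if b: "b \<in> C" for b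
    proof -
      let ?b = "inv\<^bsub>G\<^esub> g \<otimes>\<^bsub>G\<^esub> b \<otimes>\<^bsub>G\<^esub> g"
      have bG: "b \<in> carrier G" using b C by blast
      have b': "?b \<in> C" "?b \<in> carrier G" using conj[OF g b] C by auto
      have "b \<otimes>\<^bsub>G\<^esub> g = g \<otimes>\<^bsub>G\<^esub> ?b"
        using bG g by (simp add: G.m_assoc[symmetric])
      then have "ga_of k b \<otimes>\<^bsub>kG\<^esub> ga_single c g = ga_single c g \<otimes>\<^bsub>kG\<^esub> ga_of k ?b"
        using c g bG b'(2) by (simp add: ga_of_mult_single ga_single_mult_of)
      then have "ga_of k b \<odot>\<^bsub>V\<^esub> (ga_single c g \<odot>\<^bsub>V\<^esub> w)
          = ga_single c g \<odot>\<^bsub>V\<^esub> (ga_of k ?b \<odot>\<^bsub>V\<^esub> w)"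
        using s bG b'(2) w ga_of_closed by (simp add: V.smult_assoc[symmetric])
      then show ?thesis using w b'(1) by simp
    qed
    then show ?thesis using s w by (simp add: V.smult_closed)
  qed
  have sum_closed: "v \<oplus>\<^bsub>V\<^esub> w \<in> ?W" if "v \<in> ?W" "w \<in> ?W" for v w
    using that by (auto simp: V.smult_r_distr of_cl)
  have zero_in: "\<zero>\<^bsub>V\<^esub> \<in> ?W"
    by (auto simp: V.smult_r_null of_cl)
  have smult: "f \<odot>\<^bsub>V\<^esub> w \<in> ?W" if "f \<in> carrier kG" and w: "w \<in> ?W" for f w
    using that(1)
  proof (induction f rule: ga_induct)
    case zero
    then show ?case using zero_in w by (simp add: V.smult_l_null)
  next
    case (single c g)
    then show ?case using single_smult w by blast
  next
    case (add f g)
    then show ?case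
      using sum_closed[of "f \<odot>\<^bsub>V\<^esub> w" "g \<odot>\<^bsub>V\<^esub> w"] w
      by (simp add: V.smult_l_distr)
  qed
  have "subgroup ?W (add_monoid V)"
  proof (rule V.M.add.subgroupI)
    fix w assume "w \<in> ?W"
    then show "\<ominus>\<^bsub>V\<^esub> w \<in> ?W" by (auto simp: V.smult_r_minus of_cl)
  qed (use zero_in sum_closed in auto)
  then show ?thesis
    using smult by (simp add: submodule_def submodule_axioms_def)
qed

end

section \<open>Conjugates under a centralizer of finite index\<close>

text \<open>For \<open>h\<close> in the centralizer, \<open>(h g)\<^sup>-\<^sup>1 a (h g) = g\<^sup>-\<^sup>1 a g\<close>. A conjugate of \<open>a\<close> is therefore
  determined by a coset, through any representative of it.\<close>

lemma (in group) finite_conjugates: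
  assumes fin: "finite_index G (centralizer G A)" and A: "A \<subseteq> carrier G" and a: "a \<in> A"
  shows "finite ((\<lambda>g. inv g \<otimes> a \<otimes> g) ` carrier G)" (is "finite (?c ` carrier G)")
proof -
  let ?H = "centralizer G A"
  have aG: "a \<in> carrier G" using A a by blast
  have "?c ` carrier G \<subseteq> (\<lambda>K. ?c (SOME x. x \<in> K)) ` (rcosets ?H)"
  proof
    fix y assume "y \<in> ?c ` carrier G"
    then obtain g where g: "g \<in> carrier G" "y = ?c g" by blast
    have "\<one> \<in> ?H" using A by (auto simp: centralizer_def)
    then have "\<one> \<otimes> g \<in> ?H #> g" unfolding r_coset_def by blast
    then have "(SOME x. x \<in> ?H #> g) \<in> ?H #> g" by (rule someI)
    then obtain h where h: "h \<in> ?H" "(SOME x. x \<in> ?H #> g) = h \<otimes> g"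
      unfolding r_coset_def by blast
    have hG: "h \<in> carrier G" and comm: "h \<otimes> a = a \<otimes> h"
      using h(1) a by (auto simp: centralizer_def)
    have "?c (h \<otimes> g) = inv g \<otimes> (inv h \<otimes> (a \<otimes> h)) \<otimes> g"
      using hG g(1) aG by (simp add: inv_mult_group m_assoc)
    also have "inv h \<otimes> (a \<otimes> h) = a"
      using hG aG by (simp add: comm[symmetric] m_assoc[symmetric])
    finally have "y = ?c (SOME x. x \<in> ?H #> g)" using g h by simp
    moreover have "?H #> g \<in> rcosets ?H" using g(1) by (auto simp: RCOSETS_def)
    ultimately show "y \<in> (\<lambda>K. ?c (SOME x. x \<in> K)) ` (rcosets ?H)" by (rule image_eqI)
  qed
  moreover have "finite (rcosets ?H)" using fin by (simp add: finite_index_def)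
  ultimately show ?thesis by (meson finite_imageI finite_subset)
qed

lemma (in group) conjugate_pow:
  assumes "a \<in> carrier G" "g \<in> carrier G"
  shows "(inv g \<otimes> a \<otimes> g) [^] (n::nat) = inv g \<otimes> (a [^] n) \<otimes> g"
proof (induction n)
  case (Suc n)
  have "inv g \<otimes> (a [^] n) \<otimes> g \<otimes> (inv g \<otimes> a \<otimes> g)
      = inv g \<otimes> (a [^] n) \<otimes> ((g \<otimes> inv g) \<otimes> (a \<otimes> g))"
    using assms by (simp only: m_assoc m_closed inv_closed nat_pow_closed)
  then show ?case using Suc assms by (simp add: m_assoc)
qed (use assms in simp)

lemma ring_char_add_pow:
  assumes "ring_char R > 0"
  shows "[ring_char R] \<cdot>\<^bsub>R\<^esub> \<one>\<^bsub>R\<^esub> = \<zero>\<^bsub>R\<^esub>"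
proof -
  have ex: "\<exists>n::nat. n > 0 \<and> [n] \<cdot>\<^bsub>R\<^esub> \<one>\<^bsub>R\<^esub> = \<zero>\<^bsub>R\<^esub>"
    using assms by (auto simp: ring_char_def split: if_splits)
  from LeastI_ex[OF ex] show ?thesis
    unfolding ring_char_def if_P[OF ex] by simp
qed

section \<open>The characteristic and the torsion of an abelian normal subgroup\<close>

theorem theorem1p7:
  fixes k :: "('k, 'm) ring_scheme"
    and G :: "('g, 'n) monoid_scheme"
    and V :: "('g \<Rightarrow> 'k, 'v, 'o) module_scheme"
    and A :: "'g set"
  assumes "field k"
    and "group G"
    and "faithful_module k G V"
    and "irreducible_module (group_algebra k G) V"
    and "A \<lhd> G"
    and "torsion_group (G\<lparr>carrier := A\<rparr>)"
    and "comm_group (G\<lparr>carrier := A\<rparr>)"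
    and "finite_index G (centralizer G A)"
  shows "ring_char k \<notin> torsion_primes (G\<lparr>carrier := A\<rparr>)"
proof
  interpret k: field k by (rule assms(1))
  interpret G: group G by (rule assms(2))
  interpret A: normal A G by (rule assms(5))
  interpret AC: comm_group "G\<lparr>carrier := A\<rparr>" by (rule assms(7))
  interpret kG: ring_and_group k G by unfold_locales
  interpret V: left_module "group_algebra k G" V
    using assms(4) by (simp add: irreducible_module_def)
  let ?R = "group_algebra k G"
  define p where "p = ring_char k"
  assume "ring_char k \<in> torsion_primes (G\<lparr>carrier := A\<rparr>)"
  then obtain a where p: "prime p" and a: "a \<in> A" "a \<noteq> \<one>\<^bsub>G\<^esub>" "a [^]\<^bsub>G\<^esub> p = \<one>\<^bsub>G\<^esub>"
    by (auto simp: torsion_primes_def p_def nat_pow_def)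
  have aG: "a \<in> carrier G" using a(1) A.subset by blast
  have char: "[p] \<cdot>\<^bsub>?R\<^esub> \<one>\<^bsub>?R\<^esub> = \<zero>\<^bsub>?R\<^esub>"
    using ring_char_add_pow[of k] prime_gt_0_nat[OF p] by (intro kG.ga_char) (simp add: p_def)
  define C where "C = (\<lambda>g. inv\<^bsub>G\<^esub> g \<otimes>\<^bsub>G\<^esub> a \<otimes>\<^bsub>G\<^esub> g) ` carrier G"
  have C_fin: "finite C"
    unfolding C_def using G.finite_conjugates[OF assms(8) A.subset a(1)] .
  have C_A: "C \<subseteq> A"
    using A.inv_op_closed1 a(1) by (auto simp: C_def)
  then have C_G: "C \<subseteq> carrier G" using A.subset by blast
  have C_pow: "b [^]\<^bsub>G\<^esub> p = \<one>\<^bsub>G\<^esub>" if "b \<in> C" for b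
    using that aG a(3) by (auto simp: C_def G.conjugate_pow)
  have C_comm: "b \<otimes>\<^bsub>G\<^esub> c = c \<otimes>\<^bsub>G\<^esub> b" if "b \<in> C" "c \<in> C" for b c
    using AC.m_comm[of b c] that C_A by auto
  have C_conj: "inv\<^bsub>G\<^esub> g \<otimes>\<^bsub>G\<^esub> b \<otimes>\<^bsub>G\<^esub> g \<in> C" if g: "g \<in> carrier G" and b: "b \<in> C" for g b
  proof -
    obtain h where h: "h \<in> carrier G" "b = inv\<^bsub>G\<^esub> h \<otimes>\<^bsub>G\<^esub> a \<otimes>\<^bsub>G\<^esub> h" using b by (auto simp: C_def)
    then have "inv\<^bsub>G\<^esub> g \<otimes>\<^bsub>G\<^esub> b \<otimes>\<^bsub>G\<^esub> g = inv\<^bsub>G\<^esub> (h \<otimes>\<^bsub>G\<^esub> g) \<otimes>\<^bsub>G\<^esub> a \<otimes>\<^bsub>G\<^esub> (h \<otimes>\<^bsub>G\<^esub> g)"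
      using g aG by (simp add: G.inv_mult_group G.m_assoc)
    then show ?thesis using g h(1) by (auto simp: C_def)
  qed
  have "a = inv\<^bsub>G\<^esub> \<one>\<^bsub>G\<^esub> \<otimes>\<^bsub>G\<^esub> a \<otimes>\<^bsub>G\<^esub> \<one>\<^bsub>G\<^esub>" using aG by simp
  then have a_C: "a \<in> C" unfolding C_def by blast
  have of_cl: "ga_of k b \<in> carrier ?R" if "b \<in> C" for b
    using that C_G kG.ga_of_closed by blast

  let ?n = "\<lambda>b. ga_of k b \<ominus>\<^bsub>?R\<^esub> \<one>\<^bsub>?R\<^esub>"
  have n_comm: "?n b \<otimes>\<^bsub>?R\<^esub> ?n c = ?n c \<otimes>\<^bsub>?R\<^esub> ?n b" if bc: "b \<in> C" "c \<in> C" for b c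
  proof -
    have "ga_of k b \<otimes>\<^bsub>?R\<^esub> ga_of k c = ga_of k c \<otimes>\<^bsub>?R\<^esub> ga_of k b"
      using bc C_G C_comm[OF bc] by (simp add: kG.ga_of_mult subset_iff)
    with of_cl[OF bc(1)] of_cl[OF bc(2)] show ?thesis
      by (rule V.R.minus_one_commute)
  qed
  have n_nil: "?n b [^]\<^bsub>?R\<^esub> p = \<zero>\<^bsub>?R\<^esub>" if b: "b \<in> C" for b
  proof (rule V.R.nilpotent_minus_one[OF of_cl[OF b] _ p char])
    show "ga_of k b [^]\<^bsub>?R\<^esub> p = \<one>\<^bsub>?R\<^esub>"
      using b C_G C_pow[OF b] by (simp add: kG.ga_of_pow kG.ga_one subset_iff)
  qed
  have "carrier V \<noteq> {\<zero>\<^bsub>V\<^esub>}" using assms(4) by (simp add: irreducible_module_def)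
  moreover have "?n ` C \<subseteq> carrier ?R" using of_cl by auto
  moreover have "s \<otimes>\<^bsub>?R\<^esub> t = t \<otimes>\<^bsub>?R\<^esub> s" if "s \<in> ?n ` C" "t \<in> ?n ` C" for s t
    using that n_comm by blast
  moreover have "\<exists>m::nat. s [^]\<^bsub>?R\<^esub> m = \<zero>\<^bsub>?R\<^esub>" if "s \<in> ?n ` C" for s
    using that n_nil by blast
  ultimately obtain w where w: "w \<in> carrier V" "w \<noteq> \<zero>\<^bsub>V\<^esub>"
    and null: "\<And>s. s \<in> ?n ` C \<Longrightarrow> s \<odot>\<^bsub>V\<^esub> w = \<zero>\<^bsub>V\<^esub>"
    using V.common_null_vector[OF finite_imageI[OF C_fin]] by metis
  have fixed: "ga_of k b \<odot>\<^bsub>V\<^esub> w = w" if b: "b \<in> C" for b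
  proof -
    have "ga_of k b = ?n b \<oplus>\<^bsub>?R\<^esub> \<one>\<^bsub>?R\<^esub>"
      using of_cl[OF b] by (simp add: V.R.minus_eq V.R.a_assoc V.R.l_neg)
    then have "ga_of k b \<odot>\<^bsub>V\<^esub> w = ?n b \<odot>\<^bsub>V\<^esub> w \<oplus>\<^bsub>V\<^esub> \<one>\<^bsub>?R\<^esub> \<odot>\<^bsub>V\<^esub> w"
      using of_cl[OF b] w(1) V.smult_l_distr[of "?n b" "\<one>\<^bsub>?R\<^esub>" w] by simp
    then show ?thesis using null b w(1) by (simp add: V.smult_one)
  qed
  define W where "W = {v \<in> carrier V. \<forall>b\<in>C. ga_of k b \<odot>\<^bsub>V\<^esub> v = v}"
  have "submodule W ?R V"
    unfolding W_def by (rule kG.fixed_points_submodule[OF V.left_module_axioms C_G C_conj])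
  moreover have "w \<in> W" using w fixed by (simp add: W_def)
  ultimately have "W = carrier V"
    using assms(4) w(2) unfolding irreducible_module_def by blast
  then have "\<forall>v\<in>carrier V. ga_of k a \<odot>\<^bsub>V\<^esub> v = v" using a_C by (auto simp: W_def)
  then have "a = \<one>\<^bsub>G\<^esub>" using assms(3) aG by (simp add: faithful_module_def)
  then show False using a(2) by simp
qed

end
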